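(* Let $Q^T\tau$ be a cyclic system of $s$ contrasts of $v$ treatments. Then $\bar w=1_v/v$ is $\Phi$-optimal for estimating $Q^T\tau$ with respect to any orthogonally invariant information function $\Phi$.
   Context: A system of $s$ contrasts $Q^T\tau$ is given by a real $v\times s$ matrix $Q$ with $Q^T1_v=0_s$ and with no zero row; $r=\mathrm{rank}(Q)$. The system is full-rank if $s\le v$ and $r=s$, otherwise rank deficient. For a permutation $\pi$ of $\{1,\ldots,v\}$, $P_\pi$ is the $v\times v$ permutation matrix given by $\pi$, $(P_\pi x)_{\pi(i)}=x_i$. A permutation is cyclic if it consists of only one cycle, i.e. for any $i,j$ there is $m\in\mathbb{N}$ with $\pi^m(i)=j$. The system $Q^T\tau$ is called cyclic if there exists a cyclic permutation $\pi$ of $\{1,\ldots,v\}$ satisfying $P_\pi QQ^TP_\pi^T=QQ^T$. A design is $w=(w_1,\ldots,w_v)^T$ with $w_i\in[0,1]$, $\sum_iw_i=1$; it is feasible if and only if $w_i>0$ for all $i$ (written $w>0$). $M(w)=\mathrm{diag}(w)$. For $w>0$, $N_Q(w)=(Q^TM^{-1}(w)Q)^{-1}$ in the full-rank case and $C_Q(w)=(Q^TM^{-1}(w)Q)^+$ (Moore-Penrose pseudoinverse) in the rank deficient case. An information function $\Phi$ is a real function on $s\times s$ non-negative definite matrices that is positively homogeneous, superadditive, Loewner isotonic, concave and upper semicontinuous; it is orthogonally invariant if $\Phi(UHU^T)=\Phi(H)$ for every orthogonal $U$. A design is $\Phi$-optimal for $Q^T\tau$ if it maximizes $\Phi(N_Q(w))$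 (full-rank case), respectively $\Phi(C_Q(w))$ (rank deficient case), over all designs $w>0$. *)

theory Defs
  imports "HOL-Analysis.Analysis"
begin

text \<open>The treatments are indexed by the type \<open>'v\<close> and the contrasts by the type \<open>'s\<close>, so that
  \<open>v = CARD('v)\<close> and \<open>s = CARD('s)\<close>. A \<open>v \<times> s\<close> matrix has type \<open>real ^ 's ^ 'v\<close>.\<close>

definition contrast_system :: "real ^ 's ^ 'v \<Rightarrow> bool" where
  "contrast_system Q \<longleftrightarrow> transpose Q *v 1 = 0 \<and> (\<forall>i. row i Q \<noteq> 0)"

definition full_rank_system :: "real ^ 's ^ 'v \<Rightarrow> bool" where
  "full_rank_system (Q :: real ^ 's ^ 'v) \<longleftrightarrow> CARD('s) \<le> CARD('v) \<and> rank Q = CARD('s)"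

text \<open>The entry of \<open>P\<^sub>\<pi>\<close> in row \<open>a\<close> and column \<open>i\<close> is 1 iff \<open>a = \<pi> i\<close>; see the lemma below.\<close>

definition perm_matrix :: "('v \<Rightarrow> 'v) \<Rightarrow> real ^ 'v ^ 'v" where
  "perm_matrix \<pi> = (\<chi> a i. if a = \<pi> i then 1 else 0)"

lemma perm_matrix_mult_vec:
  fixes x :: "real ^ 'v"
  assumes "\<pi> permutes UNIV"
  shows "(perm_matrix \<pi> *v x) $ (\<pi> i) = x $ i"
proof -
  have "inj \<pi>" using assms by (rule permutes_inj)
  then have "(\<Sum>j\<in>UNIV. (if \<pi> i = \<pi> j then 1 else 0) * x $ j)
      = (\<Sum>j\<in>UNIV. if i = j then x $ j else 0)"
    by (intro sum.cong) (auto dest: injD)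
  then show ?thesis
    by (simp add: perm_matrix_def matrix_vector_mult_def)
qed

definition cyclic_permutation :: "('v \<Rightarrow> 'v) \<Rightarrow> bool" where
  "cyclic_permutation \<pi> \<longleftrightarrow> \<pi> permutes UNIV \<and> (\<forall>i j. \<exists>m. (\<pi> ^^ m) i = j)"

definition cyclic_system :: "real ^ 's ^ 'v \<Rightarrow> bool" where
  "cyclic_system Q \<longleftrightarrow> (\<exists>\<pi>. cyclic_permutation \<pi> \<and>
     perm_matrix \<pi> ** (Q ** transpose Q) ** transpose (perm_matrix \<pi>) = Q ** transpose Q)"

definition design :: "real ^ 'v \<Rightarrow> bool" where
  "design w \<longleftrightarrow> (\<forall>i. 0 \<le> w $ i \<and> w $ i \<le> 1) \<and> (\<Sum>i\<in>UNIV. w $ i) = 1"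

definition feasible_design :: "real ^ 'v \<Rightarrow> bool" where
  "feasible_design w \<longleftrightarrow> design w \<and> (\<forall>i. 0 < w $ i)"

definition moment_matrix :: "real ^ 'v \<Rightarrow> real ^ 'v ^ 'v" where
  "moment_matrix w = (\<chi> i j. if i = j then w $ i else 0)"

text \<open>The four Penrose conditions, which determine the pseudoinverse uniquely.\<close>

definition is_moore_penrose :: "real ^ 'n ^ 'm \<Rightarrow> real ^ 'm ^ 'n \<Rightarrow> bool" where
  "is_moore_penrose A X \<longleftrightarrow>
     A ** X ** A = A \<and> X ** A ** X = X \<and>
     transpose (A ** X) = A ** X \<and> transpose (X ** A) = X ** A"

definition moore_penrose :: "real ^ 'n ^ 'm \<Rightarrow> real ^ 'm ^ 'n" where
  "moore_penrose A = (THE X. is_moore_penrose A X)"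

definition N_mat :: "real ^ 's ^ 'v \<Rightarrow> real ^ 'v \<Rightarrow> real ^ 's ^ 's" where
  "N_mat Q w = matrix_inv (transpose Q ** matrix_inv (moment_matrix w) ** Q)"

definition C_mat :: "real ^ 's ^ 'v \<Rightarrow> real ^ 'v \<Rightarrow> real ^ 's ^ 's" where
  "C_mat Q w = moore_penrose (transpose Q ** matrix_inv (moment_matrix w) ** Q)"

definition nnd_matrices :: "(real ^ 's ^ 's) set" where
  "nnd_matrices = {H. transpose H = H \<and> (\<forall>x. 0 \<le> x \<bullet> (H *v x))}"

definition loewner_le :: "real ^ 's ^ 's \<Rightarrow> real ^ 's ^ 's \<Rightarrow> bool" where
  "loewner_le G H \<longleftrightarrow> H - G \<in> nnd_matrices"

text \<open>Criteria are total functions on matrices, but only their values on \<open>nnd_matrices\<close> are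
  constrained. The last conjunct is upper semicontinuity: all upper level sets are closed
  relative to the domain.\<close>

definition information_function :: "(real ^ 's ^ 's \<Rightarrow> real) \<Rightarrow> bool" where
  "information_function \<Phi> \<longleftrightarrow>
     (\<forall>H\<in>nnd_matrices. \<forall>c>0. \<Phi> (c *\<^sub>R H) = c * \<Phi> H) \<and>
     (\<forall>G\<in>nnd_matrices. \<forall>H\<in>nnd_matrices. \<Phi> G + \<Phi> H \<le> \<Phi> (G + H)) \<and>
     (\<forall>G\<in>nnd_matrices. \<forall>H\<in>nnd_matrices. loewner_le G H \<longrightarrow> \<Phi> G \<le> \<Phi> H) \<and>
     concave_on nnd_matrices \<Phi> \<and>
     (\<forall>a. closedin (top_of_set nnd_matrices) {H \<in> nnd_matrices. a \<le> \<Phi> H})"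

definition orthogonally_invariant :: "(real ^ 's ^ 's \<Rightarrow> real) \<Rightarrow> bool" where
  "orthogonally_invariant \<Phi> \<longleftrightarrow>
     (\<forall>U. orthogonal_matrix U \<longrightarrow> (\<forall>H\<in>nnd_matrices. \<Phi> (U ** H ** transpose U) = \<Phi> H))"

definition criterion_value ::
    "(real ^ 's ^ 's \<Rightarrow> real) \<Rightarrow> real ^ 's ^ 'v \<Rightarrow> real ^ 'v \<Rightarrow> real" where
  "criterion_value \<Phi> Q w = (if full_rank_system Q then \<Phi> (N_mat Q w) else \<Phi> (C_mat Q w))"

definition phi_optimal ::
    "(real ^ 's ^ 's \<Rightarrow> real) \<Rightarrow> real ^ 's ^ 'v \<Rightarrow> real ^ 'v \<Rightarrow> bool" where
  "phi_optimal \<Phi> Q w \<longleftrightarrow> feasible_design w \<and>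
     (\<forall>u. feasible_design u \<longrightarrow> criterion_value \<Phi> Q u \<le> criterion_value \<Phi> Q w)"

end

theory Submission
  imports Defs "HOL-Combinatorics.Cycles"
begin

text \<open>For \<open>w > 0\<close> write \<open>C(w) = (Q\<^sup>T M(w)\<^sup>-\<^sup>1 Q)\<^sup>+\<close>; in the full-rank case this is \<open>N\<^sub>Q(w)\<close>. By the Gauss--Markov
  theorem \<open>x \<bullet> C(w) x\<close> is a minimum of functions that are linear in \<open>w\<close>, so \<open>C\<close> is concave in the Loewner
  order. If \<open>\<pi>\<close> leaves \<open>Q Q\<^sup>T\<close>, the Gram matrix of the rows of \<open>Q\<close>, invariant, then some orthogonal \<open>U\<close>
  maps each row to the permuted one, so permuting \<open>w\<close> by a power of \<open>\<pi>\<close> only conjugates \<open>C(w)\<close> by an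
  orthogonal matrix and leaves \<open>\<Phi>\<close> unchanged. As \<open>\<pi>\<close> is transitive, averaging \<open>w\<close> over the powers of \<open>\<pi>\<close>
  gives the uniform design, whose criterion value is therefore at least that of \<open>w\<close>.\<close>

section \<open>Reflections, and orthogonal maps between families with equal Gram matrices\<close>

text \<open>The Householder reflection in the hyperplane orthogonal to \<open>d\<close>; for
  \<open>d = 0\<close> it degenerates to the identity.\<close>

lemma orthogonal_transformation_reflection:
  fixes d :: "'a::real_inner"
  shows "orthogonal_transformation (\<lambda>z. z - (2 * (z \<bullet> d) / (d \<bullet> d)) *\<^sub>R d)"
    (is "orthogonal_transformation ?R")
proof (cases "d = 0")
  case True
  then show ?thesis
    using orthogonal_transformation_id by (simp add: id_def)
next
  case False
  have "linear ?R"
    by (intro linearI)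
       (simp_all add: inner_add_left distrib_left add_divide_distrib scaleR_left_distrib
         scaleR_right_diff_distrib)
  moreover have "?R u \<bullet> ?R v = u \<bullet> v" for u v
  proof -
    have "?R u \<bullet> ?R v = u \<bullet> v - 4 * (u \<bullet> d) * (v \<bullet> d) / (d \<bullet> d)
        + 4 * (u \<bullet> d) * (v \<bullet> d) / ((d \<bullet> d) * (d \<bullet> d)) * (d \<bullet> d)"
      by (simp add: inner_diff_left inner_diff_right inner_commute[of d u] inner_commute[of d v] mult_ac)
    then show ?thesis
      using False by simp
  qed
  ultimately show ?thesis
    by (simp add: orthogonal_transformation_def)
qed

text \<open>Reflect in the perpendicular bisector of \<open>x\<close> and \<open>y\<close>. Equal
  norms put the origin on it, so the reflection is linear, and its fixed points are the
  \<open>z\<close> with \<open>z \<bullet> x = z \<bullet> y\<close>.\<close>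

lemma orthogonal_transformation_swapping:
  fixes x y :: "'a::real_inner"
  assumes "norm x = norm y"
  obtains R where "orthogonal_transformation R" "R x = y"
    and "\<And>z. z \<bullet> x = z \<bullet> y \<Longrightarrow> R z = z"
proof -
  define R where "R z = z - (2 * (z \<bullet> (x - y)) / ((x - y) \<bullet> (x - y))) *\<^sub>R (x - y)" for z
  have "orthogonal_transformation R"
    unfolding R_def by (rule orthogonal_transformation_reflection)
  moreover have "R x = y"
  proof (cases "x = y")
    case False
    have "x \<bullet> x = y \<bullet> y"
      using assms by (simp add: norm_eq)
    \<comment> \<open>The coefficient in \<open>R x\<close> is therefore 1, and
      \<open>R x = x - (x - y)\<close>.\<close>
    then have "2 * (x \<bullet> (x - y)) = (x - y) \<bullet> (x - y)"
      by (simp add: inner_simps inner_commute)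
    with False show ?thesis
      by (simp add: R_def)
  qed (simp add: R_def)
  moreover have "R z = z" if "z \<bullet> x = z \<bullet> y" for z
    using that by (simp add: R_def inner_simps)
  ultimately show thesis
    using that by blast
qed

text \<open>Vectors are matched one at a time: after \<open>U\<close> handles \<open>I\<close>, a
  reflection \<open>R\<close> takes \<open>U (f a)\<close> to \<open>g a\<close>. It fixes the
  \<open>g i\<close> already reached, because \<open>g i \<bullet> U (f a) = f i \<bullet> f a = g i
  \<bullet> g a\<close>.\<close>

lemma orthogonal_transformation_of_equal_Gram:
  fixes f g :: "'i \<Rightarrow> 'a::real_inner"
  assumes "finite I" and "\<And>i j. i \<in> I \<Longrightarrow> j \<in> I \<Longrightarrow> f i \<bullet> f j = g i \<bullet> g j"
  shows "\<exists>U. orthogonal_transformation U \<and> (\<forall>i\<in>I. U (f i) = g i)"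
  using assms
proof (induction I rule: finite_induct)
  case empty
  show ?case
    by (intro exI[of _ "\<lambda>x. x"]) (simp add: orthogonal_transformation_id)
next
  case (insert a I)
  then obtain U where U: "orthogonal_transformation U" "\<forall>i\<in>I. U (f i) = g i"
    by auto
  have "norm (U (f a)) = norm (g a)"
    using U(1) insert.prems[of a a]
    by (simp add: norm_eq orthogonal_transformation_def)
  then obtain R where R: "orthogonal_transformation R" "R (U (f a)) = g a"
      "\<And>z. z \<bullet> U (f a) = z \<bullet> g a \<Longrightarrow> R z = z"
    using orthogonal_transformation_swapping by blast
  have "R (g i) = g i" if "i \<in> I" for i
  proof (rule R(3))
    show "g i \<bullet> U (f a) = g i \<bullet> g a"
      using U that insert.prems[of i a] by (metis insertCI orthogonal_transformation_def)
  qed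
  then have "\<forall>i\<in>insert a I. (R \<circ> U) (f i) = g i"
    using U(2) R(2) by simp
  then show ?case
    using orthogonal_transformation_compose[OF R(1) U(1)] by blast
qed

section \<open>Matrix algebra and the Moore-Penrose pseudoinverse\<close>

lemma matrix_diff_ldistrib: "A ** (B - C) = A ** B - A ** (C :: real^_^_)"
  by (vector matrix_matrix_mult_def sum_subtractf[symmetric] field_simps)

lemma matrix_diff_rdistrib: "(A - B) ** C = A ** C - B ** (C :: real^_^_)"
  by (simp add: matrix_matrix_mult_def vec_eq_iff sum_subtractf left_diff_distrib)

lemma matrix_add_rdistrib: "(A + B) ** C = A ** C + B ** (C :: real^_^_)"
  by (vector matrix_matrix_mult_def sum.distrib[symmetric] field_simps)

lemma matrix_eq_innerI:
  fixes A B :: "real^'n^'m"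
  assumes "\<And>x y. x \<bullet> (A *v y) = x \<bullet> (B *v y)"
  shows "A = B"
  using assms by (metis matrix_eq vector_eq_ldot)

lemma matrix_inv_eqI:
  fixes A B :: "real^'n^'n"
  assumes "A ** B = mat 1"
  shows "matrix_inv A = B"
proof -
  have BA: "B ** A = mat 1"
    using assms matrix_left_right_inverse by blast
  have "A ** matrix_inv A = mat 1"
    unfolding matrix_inv_def by (rule someI2[of _ B]) (use assms BA in auto)
  then have "B = B ** (A ** matrix_inv A)"
    by simp
  then show ?thesis
    by (simp add: matrix_mul_assoc BA)
qed

text \<open>\<open>A X\<close> and \<open>A Y\<close> are both the orthogonal projection onto the
  range of \<open>A\<close>, hence equal; likewise \<open>X A = Y A\<close>. Then
  \<open>X = X A X = Y A X = Y A Y = Y\<close>.\<close>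

lemma is_moore_penrose_unique:
  assumes "is_moore_penrose A X" and "is_moore_penrose A Y"
  shows "X = Y"
proof -
  note X = assms(1)[unfolded is_moore_penrose_def]
  note Y = assms(2)[unfolded is_moore_penrose_def]
  have "A ** X = transpose (A ** X)"
    using X by simp
  also have "\<dots> = transpose ((A ** Y) ** (A ** X))"
    using Y by (simp add: matrix_mul_assoc)
  also have "\<dots> = (A ** X) ** (A ** Y)"
    using X Y by (subst matrix_transpose_mul) simp
  also have "\<dots> = A ** Y"
    using X by (simp add: matrix_mul_assoc)
  finally have AX: "A ** X = A ** Y" .
  have "X ** A = transpose (X ** A)"
    using X by simp
  also have "\<dots> = transpose ((X ** A) ** (Y ** A))"
    using Y by (metis matrix_mul_assoc)
  also have "\<dots> = (Y ** A) ** (X ** A)"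
    using X Y by (subst matrix_transpose_mul) simp
  also have "\<dots> = Y ** A"
    using X by (metis matrix_mul_assoc)
  finally have XA: "X ** A = Y ** A" .
  have "X = Y ** A ** X"
    using X XA by metis
  also have "\<dots> = Y"
    using Y AX by (metis matrix_mul_assoc)
  finally show ?thesis .
qed

lemma moore_penrose_eqI: "is_moore_penrose A X \<Longrightarrow> moore_penrose A = X"
  unfolding moore_penrose_def using is_moore_penrose_unique by blast

text \<open>The orthogonal projection onto the kernel, written as
  \<open>\<Sum>b\<in>B. (b \<bullet> x) *\<^sub>R b\<close> for an orthonormal basis
  \<open>B\<close> of it.\<close>

lemma ex_kernel_projection:
  fixes A :: "real^'n^'n"
  obtains K :: "real^'n^'n" where "transpose K = K" "K ** K = K" "A ** K = 0"
    and "\<And>x. A *v x = 0 \<Longrightarrow> K *v x = x"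
proof -
  have "subspace {x. A *v x = 0}"
    by (simp add: subspace_def matrix_vector_right_distrib matrix_vector_mult_scaleR)
  then obtain B where B: "B \<subseteq> {x. A *v x = 0}" "pairwise orthogonal B"
      "\<And>x. x \<in> B \<Longrightarrow> norm x = 1" "independent B" "span B = {x. A *v x = 0}"
    using orthonormal_basis_subspace by metis
  have "finite B"
    using B(4) by (simp add: independent_imp_finite)
  define k :: "real^'n \<Rightarrow> real^'n" where "k x = (\<Sum>b\<in>B. (b \<bullet> x) *\<^sub>R b)" for x
  have k: "k x \<in> span B" for x
    unfolding k_def by (intro span_sum span_mul span_base)
  have "linear k"
    unfolding k_def
    by (intro linearI) (simp_all add: inner_simps scaleR_left_distrib sum.distrib scaleR_right.sum)
  have k_basis: "k c = c" if "c \<in> B" for c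
  proof -
    have "(b \<bullet> c) *\<^sub>R b = (if b = c then c else 0)" if "b \<in> B" for b
      using B(2,3) that \<open>c \<in> B\<close> by (auto simp: pairwise_def orthogonal_def norm_eq_1)
    then have "k c = (\<Sum>b\<in>B. if b = c then c else 0)"
      unfolding k_def by (intro sum.cong) auto
    then show ?thesis
      using \<open>finite B\<close> that by simp
  qed
  have k_span: "k x = x" if "x \<in> span B" for x
    using linear_eq_on_span[OF \<open>linear k\<close> linear_id, of B x] k_basis that by simp
  define K where "K = matrix k"
  have K: "K *v x = k x" for x
    using \<open>linear k\<close> by (simp add: K_def matrix_works)
  show thesis
  proof (rule that)
    have "x \<bullet> (transpose K *v y) = x \<bullet> (K *v y)" for x y
    proof -
      have "x \<bullet> (transpose K *v y) = k x \<bullet> y"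
        by (metis K dot_lmul_matrix inner_commute transpose_matrix_vector)
      also have "\<dots> = x \<bullet> k y"
        by (simp add: k_def inner_sum_left inner_sum_right inner_commute mult.commute)
      finally show ?thesis
        by (simp add: K)
    qed
    then show "transpose K = K"
      by (rule matrix_eq_innerI)
    show "K ** K = K"
      by (simp add: matrix_eq K k k_span flip: matrix_vector_mul_assoc)
    show "A ** K = 0"
      using k B(5) by (auto simp: matrix_eq K simp flip: matrix_vector_mul_assoc)
    show "K *v x = x" if "A *v x = 0" for x
      using that B(5) by (simp add: K k_span)
  qed
qed

text \<open>Adding to \<open>A\<close> the orthogonal projection \<open>K\<close> onto its kernel gives an invertible matrix, and
  the pseudoinverse is \<open>(A + K)\<^sup>-\<^sup>1 - K\<close>.\<close>

lemma ex_moore_penrose_symmetric: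
  fixes A :: "real^'n^'n"
  assumes A: "transpose A = A"
  shows "\<exists>X. is_moore_penrose A X"
proof -
  obtain K where K: "transpose K = K" "K ** K = K" "A ** K = 0"
    and ker: "\<And>x. A *v x = 0 \<Longrightarrow> K *v x = x"
    using ex_kernel_projection[of A] by blast
  have KA: "K ** A = 0"
  proof -
    have "K ** A = transpose (A ** K)"
      by (simp add: matrix_transpose_mul A K(1))
    also have "\<dots> = 0"
      unfolding K(3) by (simp add: transpose_def vec_eq_iff)
    finally show ?thesis .
  qed
  \<comment> \<open>Applying \<open>K\<close> annihilates the \<open>A\<close> part and leaves
    \<open>K x = 0\<close>; then \<open>A x = 0\<close> too, so \<open>x = K x = 0\<close>.\<close>
  have "x = 0" if "(A + K) *v x = 0" for x
  proof -
    have "K *v ((A + K) *v x) = (K ** A + K ** K) *v x"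
      by (simp only: matrix_vector_mul_assoc matrix_add_ldistrib)
    then have "K *v x = 0"
      using that by (simp add: KA K(2))
    moreover from this that have "A *v x = 0"
      by (simp add: matrix_vector_mult_add_rdistrib)
    ultimately show ?thesis
      using ker by metis
  qed
  then obtain Y where Y: "Y ** (A + K) = mat 1"
    using matrix_left_invertible_ker by blast
  then have Y': "(A + K) ** Y = mat 1"
    using matrix_left_right_inverse by blast
  \<comment> \<open>\<open>A + K\<close> acts as the identity on the kernel of \<open>A\<close>,
    hence so does its inverse \<open>Y\<close>.\<close>
  have "(A + K) ** K = K" "K ** (A + K) = K"
    by (simp_all add: matrix_add_ldistrib matrix_add_rdistrib K KA)
  with Y Y' have YK: "Y ** K = K" and KY: "K ** Y = K"
    by (metis matrix_mul_assoc matrix_mul_lid, metis matrix_mul_assoc matrix_mul_rid)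
  have AY: "A ** Y = mat 1 - K" and YA: "Y ** A = mat 1 - K"
    using Y Y' by (simp_all add: matrix_add_ldistrib matrix_add_rdistrib YK KY eq_diff_eq)
  \<comment> \<open>Both products are the projection onto the orthogonal complement of the kernel,
    so both symmetry conditions follow from that of \<open>K\<close>.\<close>
  have AX: "A ** (Y - K) = mat 1 - K" and XA: "(Y - K) ** A = mat 1 - K"
    by (simp_all add: matrix_diff_ldistrib matrix_diff_rdistrib AY YA K KA)
  moreover have "transpose (mat 1 - K) = mat 1 - K"
    using K(1) transpose_mat[of 1] by (simp add: vec_eq_iff transpose_def)
  moreover have "(mat 1 - K) ** A = A" "(mat 1 - K) ** (Y - K) = Y - K"
    by (simp_all add: matrix_diff_ldistrib matrix_diff_rdistrib KA KY K)
  ultimately have "is_moore_penrose A (Y - K)"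
    by (simp add: is_moore_penrose_def)
  then show ?thesis ..
qed

lemma is_moore_penrose_transpose:
  assumes "is_moore_penrose A X"
  shows "is_moore_penrose (transpose A) (transpose X)"
proof -
  note mp = assms[unfolded is_moore_penrose_def]
  have "transpose A ** transpose X = X ** A" "transpose X ** transpose A = A ** X"
    using mp by (simp_all flip: matrix_transpose_mul)
  moreover have "transpose A ** transpose X ** transpose A = transpose (A ** X ** A)"
      "transpose X ** transpose A ** transpose X = transpose (X ** A ** X)"
    by (simp_all add: matrix_transpose_mul matrix_mul_assoc)
  ultimately show ?thesis
    using mp by (simp add: is_moore_penrose_def)
qed

text \<open>\<open>transpose X\<close> is also a pseudoinverse of \<open>A\<close>, so uniqueness
  makes \<open>X\<close> symmetric; the symmetry of \<open>A X\<close> then says that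
  \<open>A\<close> and \<open>X\<close> commute.\<close>

lemma is_moore_penrose_symmetric:
  assumes "is_moore_penrose A X" "transpose A = A"
  shows "transpose X = X" "A ** X = X ** A"
proof -
  show "transpose X = X"
    using is_moore_penrose_transpose[OF assms(1)] assms is_moore_penrose_unique by metis
  then show "A ** X = X ** A"
    using assms unfolding is_moore_penrose_def by (metis matrix_transpose_mul)
qed

lemma is_moore_penrose_conj_orthogonal:
  assumes "is_moore_penrose A X" "orthogonal_matrix U"
  shows "is_moore_penrose (U ** A ** transpose U) (U ** X ** transpose U)"
proof -
  have UU: "transpose U ** U = mat 1"
    using assms(2) by (simp add: orthogonal_matrix_def)
  have conj: "(U ** B ** transpose U) ** (U ** C ** transpose U) = U ** (B ** C) ** transpose U" for B C
    by (metis UU matrix_mul_assoc matrix_mul_rid)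
  have "transpose (U ** B ** transpose U) = U ** transpose B ** transpose U" for B
    by (simp add: matrix_transpose_mul matrix_mul_assoc)
  then show ?thesis
    using assms(1) by (simp add: is_moore_penrose_def conj)
qed

lemma is_moore_penrose_matrix_inv:
  fixes A X :: "real^'n^'n"
  assumes "X ** A = mat 1"
  shows "is_moore_penrose A (matrix_inv A)"
proof -
  have "A ** X = mat 1"
    using assms matrix_left_right_inverse by blast
  then show ?thesis
    using assms matrix_inv_eqI[of A X] by (simp add: is_moore_penrose_def transpose_mat)
qed

section \<open>The matrix behind \<open>N_mat\<close> and \<open>C_mat\<close>\<close>

text \<open>Despite the name, this is up to scale the covariance matrix of the least squares
  estimator of the contrasts; the information is its inverse or pseudoinverse.\<close>

definition info_matrix :: "real ^ 's ^ 'v \<Rightarrow> real ^ 'v \<Rightarrow> real ^ 's ^ 's" where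
  "info_matrix Q w = transpose Q ** matrix_inv (moment_matrix w) ** Q"

lemma N_mat_eq: "N_mat Q w = matrix_inv (info_matrix Q w)"
  by (simp add: N_mat_def info_matrix_def)

lemma C_mat_eq: "C_mat Q w = moore_penrose (info_matrix Q w)"
  by (simp add: C_mat_def info_matrix_def)

lemma moment_matrix_mult:
  "moment_matrix a ** moment_matrix b = (\<chi> i j. if i = j then a $ i * b $ i else 0)"
proof -
  have "(\<Sum>k\<in>UNIV. (if i = k then a $ i else 0) * (if k = j then b $ k else 0))
      = (\<Sum>k\<in>UNIV. if i = k then (if i = j then a $ i * b $ i else 0) else 0)" for i j
    by (intro sum.cong) auto
  then show ?thesis
    by (simp add: moment_matrix_def matrix_matrix_mult_def vec_eq_iff)
qed

lemma matrix_inv_moment_matrix: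
  assumes "\<And>i. 0 < w $ i"
  shows "matrix_inv (moment_matrix w) = moment_matrix (\<chi> i. 1 / w $ i)"
proof (rule matrix_inv_eqI)
  have "w $ i \<noteq> 0" for i
    using assms[of i] by simp
  then show "moment_matrix w ** moment_matrix (\<chi> i. 1 / w $ i) = mat 1"
    by (simp add: moment_matrix_mult mat_def vec_eq_iff)
qed

text \<open>The matrix is a sum of rank-one terms \<open>Q_i Q_i^T / w_i\<close> over the rows of
  \<open>Q\<close>; later arguments see \<open>w\<close> and \<open>Q\<close> in this form.\<close>

lemma info_matrix_mult_vec:
  assumes "\<And>i. 0 < w $ i"
  shows "info_matrix Q w *v x = (\<Sum>i\<in>UNIV. ((Q $ i \<bullet> x) / w $ i) *\<^sub>R Q $ i)"
proof -
  have "(moment_matrix u *v y) $ i = u $ i * y $ i" for u y :: "real^'a" and i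
    by (simp add: moment_matrix_def matrix_vector_mult_def if_distrib if_distribR cong: if_cong)
  then show ?thesis
    unfolding info_matrix_def matrix_inv_moment_matrix[OF assms] matrix_vector_mul_assoc[symmetric]
    by (simp add: vec_eq_iff vector_matrix_mult_def matrix_vector_mul_component mult.commute)
qed

lemma inner_info_matrix:
  assumes "\<And>i. 0 < w $ i"
  shows "y \<bullet> (info_matrix Q w *v x) = (\<Sum>i\<in>UNIV. (Q $ i \<bullet> x) * (Q $ i \<bullet> y) / w $ i)"
  by (simp add: info_matrix_mult_vec assms inner_sum_right inner_commute)

lemma transpose_info_matrix:
  assumes "\<And>i. 0 < w $ i"
  shows "transpose (info_matrix Q w) = info_matrix Q w"
proof -
  have "y \<bullet> (transpose (info_matrix Q w) *v x) = y \<bullet> (info_matrix Q w *v x)" for x y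
  proof -
    have "y \<bullet> (transpose (info_matrix Q w) *v x) = x \<bullet> (info_matrix Q w *v y)"
      by (metis dot_lmul_matrix inner_commute transpose_matrix_vector)
    then show ?thesis
      by (simp add: inner_info_matrix assms mult.commute)
  qed
  then show ?thesis
    by (rule matrix_eq_innerI)
qed

text \<open>The quadratic form is a sum of nonnegative terms, each of which must vanish. The kernel
  is thus the orthogonal complement of the row space, the same for every positive
  \<open>w\<close>.\<close>

lemma info_matrix_mult_vec_eq_0_iff:
  assumes "\<And>i. 0 < w $ i"
  shows "info_matrix Q w *v x = 0 \<longleftrightarrow> (\<forall>i. Q $ i \<bullet> x = 0)"
proof
  assume "info_matrix Q w *v x = 0"
  then have "(\<Sum>i\<in>UNIV. (Q $ i \<bullet> x) * (Q $ i \<bullet> x) / w $ i) = 0"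
    using inner_info_matrix[OF assms, of x Q x] by simp
  then have "(Q $ i \<bullet> x) * (Q $ i \<bullet> x) / w $ i = 0" for i
    using assms by (subst (asm) sum_nonneg_eq_0_iff) (auto simp: less_imp_le)
  then show "\<forall>i. Q $ i \<bullet> x = 0"
    using assms by (metis divide_eq_0_iff less_irrefl mult_eq_0_iff)
qed (simp add: info_matrix_mult_vec assms)

lemma is_moore_penrose_C_mat:
  assumes "\<And>i. 0 < w $ i"
  shows "is_moore_penrose (info_matrix Q w) (C_mat Q w)"
proof -
  obtain X where X: "is_moore_penrose (info_matrix Q w) X"
    using ex_moore_penrose_symmetric[OF transpose_info_matrix[OF assms]] by blast
  then show ?thesis
    by (simp add: C_mat_eq moore_penrose_eqI)
qed

text \<open>Full rank makes the kernel trivial, and the pseudoinverse of an invertible matrix is its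
  inverse. This lets \<open>C_mat\<close> serve both cases of the criterion.\<close>

lemma N_mat_eq_C_mat:
  assumes "\<And>i. 0 < w $ i" "full_rank_system Q"
  shows "N_mat Q w = C_mat Q w"
proof -
  have inj: "inj ((*v) Q)"
    using assms(2) by (simp add: full_rank_system_def full_rank_injective)
  have "x = 0" if "info_matrix Q w *v x = 0" for x
  proof -
    have "\<forall>i. Q $ i \<bullet> x = 0"
      using that info_matrix_mult_vec_eq_0_iff[OF assms(1)] by blast
    then have "Q *v x = Q *v 0"
      by (simp add: vec_eq_iff matrix_vector_mul_component)
    then show ?thesis
      using inj by (rule injD[rotated])
  qed
  then obtain X where "X ** info_matrix Q w = mat 1"
    using matrix_left_invertible_ker by blast
  then show ?thesis
    using moore_penrose_eqI[OF is_moore_penrose_matrix_inv] by (metis N_mat_eq C_mat_eq)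
qed

section \<open>The quadratic form of \<open>C_mat\<close> as a minimum\<close>

text \<open>From \<open>C = C A C\<close> and the symmetry of \<open>C\<close>, the left side is the
  quadratic form of \<open>A\<close> at \<open>C x\<close>.\<close>

lemma inner_C_mat:
  assumes "\<And>i. 0 < w $ i"
  shows "x \<bullet> (C_mat Q w *v x) = (\<Sum>i\<in>UNIV. (Q $ i \<bullet> (C_mat Q w *v x))\<^sup>2 / w $ i)"
proof -
  let ?A = "info_matrix Q w" and ?C = "C_mat Q w"
  note mp = is_moore_penrose_C_mat[OF assms, of Q]
  have sym: "transpose ?C = ?C"
    by (rule is_moore_penrose_symmetric[OF mp transpose_info_matrix[OF assms]])
  have "?C *v x = ?C *v (?A *v (?C *v x))"
    using mp by (simp add: matrix_vector_mul_assoc matrix_mul_assoc is_moore_penrose_def)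
  then have "x \<bullet> (?C *v x) = (?C *v x) \<bullet> (?A *v (?C *v x))"
    by (metis sym dot_lmul_matrix vector_transpose_matrix)
  then show ?thesis
    by (simp add: inner_info_matrix assms power2_eq_square)
qed

lemma C_mat_nnd:
  assumes "\<And>i. 0 < w $ i"
  shows "C_mat Q w \<in> nnd_matrices"
proof -
  have "transpose (C_mat Q w) = C_mat Q w"
    by (rule is_moore_penrose_symmetric[OF is_moore_penrose_C_mat[OF assms]
          transpose_info_matrix[OF assms]])
  moreover have "0 \<le> x \<bullet> (C_mat Q w *v x)" for x
    unfolding inner_C_mat[OF assms] using assms by (intro sum_nonneg) (simp add: less_imp_le)
  ultimately show ?thesis
    by (simp add: nnd_matrices_def)
qed

text \<open>The Gauss--Markov theorem: \<open>\<Sum>i. w\<^sub>i l\<^sub>i\<^sup>2\<close> is minimal, over the \<open>l\<close> whose combination of the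
  rows of \<open>Q\<close> is the projection of \<open>x\<close> onto the row space, at \<open>l\<^sub>i = (Q\<^sub>i \<bullet> C x) / w\<^sub>i\<close>. Since the
  constraint does not mention \<open>w\<close>, this makes \<open>C\<close> concave in \<open>w\<close>.\<close>

lemma inner_C_mat_le:
  assumes w: "\<And>i. 0 < w $ i"
    and l: "\<And>j. Q $ j \<bullet> (x - (\<Sum>i\<in>UNIV. l i *\<^sub>R Q $ i)) = 0"
  shows "x \<bullet> (C_mat Q w *v x) \<le> (\<Sum>i\<in>UNIV. w $ i * (l i)\<^sup>2)"
proof -
  let ?A = "info_matrix Q w" and ?C = "C_mat Q w"
  define z where "z = ?C *v x"
  define u where "u = x - (\<Sum>i\<in>UNIV. l i *\<^sub>R Q $ i)"
  note mp = is_moore_penrose_C_mat[OF w, of Q]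
  note C = is_moore_penrose_symmetric[OF mp transpose_info_matrix[OF w]]
  \<comment> \<open>The residual \<open>u\<close> lies in the kernel of \<open>A\<close>, which
    \<open>C = C C A\<close> annihilates. So \<open>u\<close> is orthogonal to
    \<open>z = C x\<close>, and \<open>x \<bullet> z\<close> depends only on the combination of
    rows.\<close>
  have "?A *v u = 0"
    using l by (simp add: info_matrix_mult_vec_eq_0_iff w u_def)
  moreover have "?C = ?C ** (?C ** ?A)"
    using mp C(2) by (metis is_moore_penrose_def matrix_mul_assoc)
  ultimately have "?C *v u = 0"
    by (metis matrix_vector_mul_assoc matrix_vector_mult_0_right)
  then have "u \<bullet> z = 0"
    unfolding z_def by (metis C(1) dot_lmul_matrix inner_zero_left vector_transpose_matrix)
  then have lin: "x \<bullet> z = (\<Sum>i\<in>UNIV. l i * (Q $ i \<bullet> z))"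
    by (simp add: u_def inner_diff_left inner_sum_left)
  have quad: "x \<bullet> z = (\<Sum>i\<in>UNIV. (Q $ i \<bullet> z)\<^sup>2 / w $ i)"
    unfolding z_def by (rule inner_C_mat[OF w])
  \<comment> \<open>Weighted squared distance of \<open>l\<close> from the optimal weights; by
    \<open>lin\<close> and \<open>quad\<close> the cross term is \<open>-2 (x \<bullet> z)\<close>
    and the last term \<open>x \<bullet> z\<close>.\<close>
  have "0 \<le> (\<Sum>i\<in>UNIV. w $ i * (l i - (Q $ i \<bullet> z) / w $ i)\<^sup>2)"
    using w by (intro sum_nonneg) (simp add: less_imp_le)
  also have "\<dots> = (\<Sum>i\<in>UNIV. w $ i * (l i)\<^sup>2 - 2 * (l i * (Q $ i \<bullet> z)) + (Q $ i \<bullet> z)\<^sup>2 / w $ i)"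
  proof (rule sum.cong)
    fix i
    have "w $ i \<noteq> 0"
      using w[of i] by simp
    then show "w $ i * (l i - (Q $ i \<bullet> z) / w $ i)\<^sup>2
        = w $ i * (l i)\<^sup>2 - 2 * (l i * (Q $ i \<bullet> z)) + (Q $ i \<bullet> z)\<^sup>2 / w $ i"
      by (simp add: field_simps power2_eq_square)
  qed simp
  also have "\<dots> = (\<Sum>i\<in>UNIV. w $ i * (l i)\<^sup>2) - 2 * (x \<bullet> z) + x \<bullet> z"
    unfolding sum.distrib sum_subtractf sum_distrib_left[symmetric] lin[symmetric] quad[symmetric] ..
  finally show ?thesis
    by (simp add: z_def)
qed

lemma Gauss_Markov_weights:
  assumes w: "\<And>i. 0 < w $ i"
  obtains l where "\<And>j. Q $ j \<bullet> (x - (\<Sum>i\<in>UNIV. l i *\<^sub>R Q $ i)) = 0"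
    and "x \<bullet> (C_mat Q w *v x) = (\<Sum>i\<in>UNIV. w $ i * (l i)\<^sup>2)"
proof
  let ?A = "info_matrix Q w" and ?C = "C_mat Q w"
  let ?l = "\<lambda>i. (Q $ i \<bullet> (?C *v x)) / w $ i"
  note mp = is_moore_penrose_C_mat[OF w, of Q]
  note C = is_moore_penrose_symmetric[OF mp transpose_info_matrix[OF w]]
  \<comment> \<open>These weights combine the rows to \<open>A C x\<close>. As \<open>A\<close> and
    \<open>C\<close> commute, \<open>A A C = A C A = A\<close>, so the residual is in the kernel,
    which is the constraint on \<open>l\<close>.\<close>
  have "?A *v (x - ?A *v (?C *v x)) = ?A *v x - (?A ** (?A ** ?C)) *v x"
    by (simp add: matrix_vector_mult_diff_distrib matrix_vector_mul_assoc matrix_mul_assoc)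
  also have "?A ** (?A ** ?C) = ?A"
    using mp C(2) by (metis is_moore_penrose_def matrix_mul_assoc)
  finally have "?A *v (x - ?A *v (?C *v x)) = 0"
    by simp
  then show "Q $ j \<bullet> (x - (\<Sum>i\<in>UNIV. ?l i *\<^sub>R Q $ i)) = 0" for j
    by (simp add: info_matrix_mult_vec_eq_0_iff w) (simp add: info_matrix_mult_vec w)
  have "(Q $ i \<bullet> (?C *v x))\<^sup>2 / w $ i = w $ i * (?l i)\<^sup>2" for i
    using w[of i] by (simp add: field_simps power2_eq_square)
  then show "x \<bullet> (?C *v x) = (\<Sum>i\<in>UNIV. w $ i * (?l i)\<^sup>2)"
    by (subst inner_C_mat[OF w]) (simp only:)
qed

section \<open>Averaging designs in the Loewner order\<close>

lemma sum_matrix_vector_mult: "(\<Sum>k\<in>K. F k) *v x = (\<Sum>k\<in>K. F k *v (x :: real^'n))"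
  by (induction K rule: infinite_finite_induct) (auto simp: matrix_vector_mult_add_rdistrib)

lemma transpose_sum: "transpose (\<Sum>k\<in>K. F k :: real^'n^'m) = (\<Sum>k\<in>K. transpose (F k))"
  by (simp add: vec_eq_iff transpose_def)

lemma sum_nnd_matrices:
  assumes "\<And>k. k \<in> K \<Longrightarrow> F k \<in> nnd_matrices"
  shows "(\<Sum>k\<in>K. F k) \<in> nnd_matrices"
  using assms by (auto simp: nnd_matrices_def transpose_sum sum_matrix_vector_mult inner_sum_right intro: sum_nonneg)

lemma scaleR_nnd_matrices:
  assumes "H \<in> nnd_matrices" "0 \<le> c"
  shows "c *\<^sub>R H \<in> nnd_matrices"
  using assms by (auto simp: nnd_matrices_def transpose_scalar simp flip: scaleR_matrix_vector_assoc)

lemma loewner_leI: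
  assumes "G \<in> nnd_matrices" "H \<in> nnd_matrices" "\<And>x. x \<bullet> (G *v x) \<le> x \<bullet> (H *v x)"
  shows "loewner_le G H"
  using assms
  by (auto simp: loewner_le_def nnd_matrices_def matrix_vector_mult_diff_rdistrib inner_diff_right
      vec_eq_iff transpose_def)

text \<open>The weights \<open>l\<close> optimal for \<open>u\<close> are admissible for every
  \<open>w k\<close>, since the constraint is free of the design. The resulting bounds are linear in
  \<open>w k\<close> and add up to \<open>n\<close> times the exact value for
  \<open>u\<close>.\<close>

lemma sum_C_mat_loewner_le:
  assumes "finite K" and w: "\<And>k i. k \<in> K \<Longrightarrow> 0 < w k $ i"
    and u: "\<And>i. 0 < u $ i" and avg: "(\<Sum>k\<in>K. w k) = n *\<^sub>R u" and n: "0 < n"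
  shows "loewner_le ((1 / n) *\<^sub>R (\<Sum>k\<in>K. C_mat Q (w k))) (C_mat Q u)"
proof (rule loewner_leI)
  show "(1 / n) *\<^sub>R (\<Sum>k\<in>K. C_mat Q (w k)) \<in> nnd_matrices"
    using n w by (intro scaleR_nnd_matrices sum_nnd_matrices C_mat_nnd) auto
  show "C_mat Q u \<in> nnd_matrices"
    using u by (rule C_mat_nnd)
  fix x
  obtain l where l: "\<And>j. Q $ j \<bullet> (x - (\<Sum>i\<in>UNIV. l i *\<^sub>R Q $ i)) = 0"
    and x: "x \<bullet> (C_mat Q u *v x) = (\<Sum>i\<in>UNIV. u $ i * (l i)\<^sup>2)"
    using Gauss_Markov_weights[OF u, of Q x] by blast
  have "(\<Sum>k\<in>K. w k $ i) = n * u $ i" for i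
    using arg_cong[OF avg, of "\<lambda>v. v $ i"] by simp
  then have "(\<Sum>k\<in>K. \<Sum>i\<in>UNIV. w k $ i * (l i)\<^sup>2) = n * (\<Sum>i\<in>UNIV. u $ i * (l i)\<^sup>2)"
    by (subst sum.swap) (simp add: sum_distrib_right[symmetric] sum_distrib_left mult.assoc)
  moreover have "(\<Sum>k\<in>K. x \<bullet> (C_mat Q (w k) *v x)) \<le> (\<Sum>k\<in>K. \<Sum>i\<in>UNIV. w k $ i * (l i)\<^sup>2)"
    using w l by (intro sum_mono inner_C_mat_le) auto
  ultimately have "(\<Sum>k\<in>K. x \<bullet> (C_mat Q (w k) *v x)) \<le> n * (x \<bullet> (C_mat Q u *v x))"
    by (simp add: x)
  then show "x \<bullet> ((1 / n) *\<^sub>R (\<Sum>k\<in>K. C_mat Q (w k)) *v x) \<le> x \<bullet> (C_mat Q u *v x)"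
    using n by (simp add: sum_matrix_vector_mult inner_sum_right field_simps flip: scaleR_matrix_vector_assoc)
qed

lemma information_function_sum_le:
  assumes "information_function \<Phi>" "finite K" "K \<noteq> {}" "\<And>k. k \<in> K \<Longrightarrow> F k \<in> nnd_matrices"
  shows "(\<Sum>k\<in>K. \<Phi> (F k)) \<le> \<Phi> (\<Sum>k\<in>K. F k)"
  using assms(2-)
proof (induction K rule: finite_ne_induct)
  case (insert a K)
  then have "\<Phi> (F a) + (\<Sum>k\<in>K. \<Phi> (F k)) \<le> \<Phi> (F a) + \<Phi> (\<Sum>k\<in>K. F k)"
    by simp
  also have "\<dots> \<le> \<Phi> (F a + (\<Sum>k\<in>K. F k))"
    using assms(1) insert.prems sum_nnd_matrices[of K F] by (simp add: information_function_def)
  finally show ?case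
    using insert.hyps by simp
qed simp

section \<open>Action of the symmetry on designs and on \<open>C_mat\<close>\<close>

text \<open>An orthogonal \<open>g\<close> carries row \<open>i\<close> to row
  \<open>\<sigma> i\<close>. Conjugation by it turns the terms
  \<open>Q_i Q_i^T / w_(\<sigma> i)\<close> into those of \<open>w\<close>, reindexed by
  \<open>\<sigma>\<close>, and pseudoinverses follow the conjugation.\<close>

lemma C_mat_permute_design:
  fixes Q :: "real ^ 's ^ 'v"
  assumes w: "\<And>i. 0 < w $ i" and "bij \<sigma>"
    and gram: "\<And>i j. Q $ \<sigma> i \<bullet> Q $ \<sigma> j = Q $ i \<bullet> Q $ j"
  obtains U where "orthogonal_matrix U"
    and "C_mat Q w = U ** C_mat Q (\<chi> i. w $ \<sigma> i) ** transpose U"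
proof -
  let ?w = "\<chi> i. w $ \<sigma> i"
  have w': "0 < ?w $ i" for i
    using w by simp
  obtain g where g: "orthogonal_transformation g" "\<And>i. g (Q $ i) = Q $ \<sigma> i"
    using orthogonal_transformation_of_equal_Gram[of UNIV "\<lambda>i. Q $ i" "\<lambda>i. Q $ \<sigma> i"] gram by auto
  define U where "U = matrix g"
  have U: "orthogonal_matrix U"
    using g(1) by (simp add: U_def orthogonal_transformation_matrix)
  have Ug: "U *v x = g x" for x
    using g(1) by (simp add: U_def matrix_works orthogonal_transformation_linear)
  have adj: "a \<bullet> (transpose U *v x) = g a \<bullet> x" for a x
    by (metis Ug dot_lmul_matrix inner_commute transpose_matrix_vector)
  have "U ** info_matrix Q ?w ** transpose U = info_matrix Q w"
    unfolding matrix_eq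
  proof
    fix x
    have "(U ** info_matrix Q ?w ** transpose U) *v x
        = g (info_matrix Q ?w *v (transpose U *v x))"
      by (simp only: matrix_vector_mul_assoc[symmetric] Ug)
    also have "\<dots> = (\<Sum>i\<in>UNIV. ((Q $ \<sigma> i \<bullet> x) / w $ \<sigma> i) *\<^sub>R Q $ \<sigma> i)"
      unfolding info_matrix_mult_vec[OF w'] adj g(2)
      using g orthogonal_transformation_linear[OF g(1)]
      by (simp add: linear_sum linear_scale)
    also have "\<dots> = (\<Sum>i\<in>UNIV. ((Q $ i \<bullet> x) / w $ i) *\<^sub>R Q $ i)"
      by (rule sum.reindex_bij_betw) (rule \<open>bij \<sigma>\<close>)
    finally show "(U ** info_matrix Q ?w ** transpose U) *v x = info_matrix Q w *v x"
      by (simp only: info_matrix_mult_vec[OF w])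
  qed
  then have "is_moore_penrose (info_matrix Q w) (U ** C_mat Q ?w ** transpose U)"
    using is_moore_penrose_conj_orthogonal[OF is_moore_penrose_C_mat[OF w'] U] by metis
  then have "C_mat Q w = U ** C_mat Q ?w ** transpose U"
    using is_moore_penrose_unique is_moore_penrose_C_mat[OF w] by blast
  with U show thesis
    using that by blast
qed

text \<open>Entry \<open>(i, j)\<close> of \<open>Q Q^T\<close> is \<open>Q_i \<bullet> Q_j\<close>,
  and conjugation by the permutation matrix moves it to position
  \<open>(\<pi> i, \<pi> j)\<close>.\<close>

lemma gram_invariant_of_permuted:
  fixes Q :: "real ^ 's ^ 'v"
  assumes "\<pi> permutes UNIV"
    and "perm_matrix \<pi> ** (Q ** transpose Q) ** transpose (perm_matrix \<pi>) = Q ** transpose Q"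
  shows "Q $ \<pi> i \<bullet> Q $ \<pi> j = Q $ i \<bullet> Q $ j"
proof -
  let ?G = "Q ** transpose Q" and ?P = "perm_matrix \<pi>"
  have inj: "\<pi> a = \<pi> b \<longleftrightarrow> a = b" for a b
    using permutes_inj[OF assms(1)] by (simp add: inj_eq)
  have left: "(?P ** B) $ \<pi> a $ b = B $ a $ b" for B :: "real^'n^'v" and a b
    by (simp add: matrix_matrix_mult_def perm_matrix_def inj if_distrib if_distribR cong: if_cong)
  have right: "(B ** transpose ?P) $ a $ \<pi> b = B $ a $ b" for B :: "real^'v^'m" and a b
    by (simp add: matrix_matrix_mult_def perm_matrix_def transpose_def inj if_distrib if_distribR
        cong: if_cong)
  have "?G $ \<pi> i $ \<pi> j = (?P ** ?G ** transpose ?P) $ \<pi> i $ \<pi> j"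
    using assms(2) by simp
  also have "\<dots> = ?G $ i $ j"
    by (simp only: left right)
  finally show ?thesis
    by (simp add: matrix_mult_transpose_dot_row row_def)
qed

text \<open>The orbit sum is invariant under \<open>\<pi>\<close>, hence constant by transitivity;
  summing it over all treatments determines the constant.\<close>

lemma cyclic_permutation_orbit_average:
  fixes w :: "real ^ 'v"
  assumes "cyclic_permutation \<pi>" and "(\<pi> ^^ n) = id"
  shows "(\<Sum>k<n. \<chi> i. w $ (\<pi> ^^ k) i) = (real n * (\<Sum>i\<in>UNIV. w $ i) / real CARD('v)) *\<^sub>R 1"
proof -
  have bij: "bij (\<pi> ^^ k)" for k
    using assms(1) by (auto simp: cyclic_permutation_def intro: bij_fn permutes_bij)
  define a where "a i = (\<Sum>k<n. w $ (\<pi> ^^ k) i)" for i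
  have step: "a (\<pi> i) = a i" for i
  proof -
    \<comment> \<open>Splitting off the term \<open>k = n\<close> instead of \<open>k = 0\<close>
      gives \<open>a i + w $ i\<close>, because \<open>\<pi> ^^ n\<close> is the identity.\<close>
    have "a (\<pi> i) + w $ i = (\<Sum>k<Suc n. w $ (\<pi> ^^ k) i)"
      unfolding a_def by (subst sum.lessThan_Suc_shift) (simp add: funpow_swap1)
    then show ?thesis
      using assms(2) by (simp add: a_def)
  qed
  have "a ((\<pi> ^^ m) i) = a i" for m i
    by (induction m) (simp_all add: step)
  then have const: "a j = a i" for i j
    using assms(1) unfolding cyclic_permutation_def by metis
  have "(\<Sum>j\<in>UNIV. a j) = (\<Sum>k<n. \<Sum>j\<in>UNIV. w $ (\<pi> ^^ k) j)"
    unfolding a_def by (rule sum.swap)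
  also have "\<dots> = real n * (\<Sum>i\<in>UNIV. w $ i)"
    using sum.reindex_bij_betw[OF bij, of "\<lambda>i. w $ i"] by simp
  finally have total: "(\<Sum>j\<in>UNIV. a j) = real n * (\<Sum>i\<in>UNIV. w $ i)" .
  have "real CARD('v) * a i = (\<Sum>j\<in>UNIV. a j)" for i
    using sum.cong[of UNIV UNIV a "\<lambda>_. a i"] const by simp
  then have "a i = real n * (\<Sum>i\<in>UNIV. w $ i) / real CARD('v)" for i
    by (simp add: total field_simps)
  then show ?thesis
    by (simp add: vec_eq_iff a_def)
qed

theorem theorem5:
  fixes Q :: "real ^ 's ^ 'v" and \<Phi> :: "real ^ 's ^ 's \<Rightarrow> real"
  assumes "contrast_system Q"
    and "cyclic_system Q"
    and "information_function \<Phi>"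
    and "orthogonally_invariant \<Phi>"
  shows "phi_optimal \<Phi> Q ((1 / real CARD('v)) *\<^sub>R 1)"
proof -
  let ?u = "(1 / real CARD('v)) *\<^sub>R (1 :: real ^ 'v)"
  have u: "0 < ?u $ i" for i
    by simp
  have "feasible_design ?u"
    by (auto simp: feasible_design_def design_def divide_le_eq_1)
  moreover have "criterion_value \<Phi> Q w \<le> criterion_value \<Phi> Q ?u" if "feasible_design w" for w
  proof -
    have w: "0 < w $ i" and sum_w: "(\<Sum>i\<in>UNIV. w $ i) = 1" for i
      using that by (auto simp: feasible_design_def design_def)
    obtain \<pi> where \<pi>: "cyclic_permutation \<pi>"
      and G: "perm_matrix \<pi> ** (Q ** transpose Q) ** transpose (perm_matrix \<pi>) = Q ** transpose Q"
      using assms(2) by (auto simp: cyclic_system_def)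
    have perm: "\<pi> permutes UNIV"
      using \<pi> by (simp add: cyclic_permutation_def)
    \<comment> \<open>A permutation of a finite set has finite order.\<close>
    then obtain n where n: "(\<pi> ^^ n) = id" "0 < n"
      using permutation_is_nilpotent[of \<pi>] permutation_permutes[of \<pi>] finite by metis
    define W where "W k = (\<chi> i. w $ (\<pi> ^^ k) i)" for k
    have W: "0 < W k $ i" for k i
      by (simp add: W_def w)
    have "Q $ (\<pi> ^^ k) i \<bullet> Q $ (\<pi> ^^ k) j = Q $ i \<bullet> Q $ j" for k i j
      by (induction k) (simp_all add: gram_invariant_of_permuted[OF perm G])
    moreover have "bij (\<pi> ^^ k)" for k
      using perm by (intro bij_fn permutes_bij)
    ultimately have "\<exists>U. orthogonal_matrix U \<and> C_mat Q w = U ** C_mat Q (W k) ** transpose U" for k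
      unfolding W_def using C_mat_permute_design[OF w] by metis
    then have \<Phi>_W: "\<Phi> (C_mat Q (W k)) = \<Phi> (C_mat Q w)" for k
      using assms(4) C_mat_nnd[OF W] by (metis orthogonally_invariant_def)
    let ?S = "\<Sum>k<n. C_mat Q (W k)"
    have S: "?S \<in> nnd_matrices"
      by (intro sum_nnd_matrices C_mat_nnd W)
    \<comment> \<open>The criterion is constant along the orbit; superadditivity and homogeneity
      with factor \<open>1 / n\<close> then bound it by its value at the averaged matrix.\<close>
    have "real n * \<Phi> (C_mat Q w) = (\<Sum>k<n. \<Phi> (C_mat Q (W k)))"
      by (simp add: \<Phi>_W)
    also have "\<dots> \<le> \<Phi> ?S"
      using n by (intro information_function_sum_le assms C_mat_nnd W) auto
    finally have "\<Phi> (C_mat Q w) \<le> (1 / real n) * \<Phi> ?S"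
      using n by (simp add: field_simps)
    also have "\<dots> = \<Phi> ((1 / real n) *\<^sub>R ?S)"
      using assms(3) S n by (simp add: information_function_def)
    also have "\<dots> \<le> \<Phi> (C_mat Q ?u)"
    proof -
      have "loewner_le ((1 / real n) *\<^sub>R ?S) (C_mat Q ?u)"
        using cyclic_permutation_orbit_average[OF \<pi> n(1), of w] n(2)
        by (intro sum_C_mat_loewner_le W u) (simp_all add: W_def sum_w)
      moreover have "(1 / real n) *\<^sub>R ?S \<in> nnd_matrices"
        by (intro scaleR_nnd_matrices S) simp
      ultimately show ?thesis
        using assms(3) C_mat_nnd[OF u] unfolding information_function_def by blast
    qed
    finally show ?thesis
      by (simp add: criterion_value_def N_mat_eq_C_mat w)
  qed
  ultimately show ?thesis
    by (simp add: phi_optimal_def)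
qed

end
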